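(* If the vertex set of a graph $G$ can be partitioned into $t$ sets each inducing a forest, then $\mathring{s}(G)\le\frac{3t}{2}|V(G)|$. If it can be partitioned into one independent set and $t-1$ sets each inducing a forest, then $\mathring{s}(G)\le\frac{3t-1}{2}|V(G)|$.
   Context: The slow-coloring game on a graph $G$: initially all vertices are uncolored. In each round, Lister marks a nonempty set $M$ of uncolored vertices and scores $|M|$; Painter then colors (with a new color) a subset $X\subseteq M$ that is independent in $G$. The game ends when all vertices are colored; the score is the sum of the sizes of all marked sets. Painter minimizes, Lister maximizes. The sum-color cost $\mathring{s}(G)$ is the score under optimal play by both players. *)

theory Defs
  imports Complex_Main "HOL-Library.Disjoint_Sets" "Graph_Theory.Graph_Theory"
begin

text \<open>
  Finite simple undirected graphs are the models of the locale \<^locale>\<open>graph\<close>: every edge is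
  a pair of opposite arcs.  Traversing an edge back and forth is then a
  \<^const>\<open>pre_digraph.cycle\<close> of length 2, so the library's \<^const>\<open>forest\<close> holds only for
  edgeless symmetric digraphs.  The cycles of the undirected graph are those of length at least 3.
\<close>

definition undirected_forest :: "('a, 'b) pre_digraph \<Rightarrow> bool" where
  "undirected_forest G \<longleftrightarrow> \<not> (\<exists>p. pre_digraph.cycle G p \<and> 3 \<le> length p)"

definition indep_set :: "('a, 'b) pre_digraph \<Rightarrow> 'a set \<Rightarrow> bool" where
  "indep_set G X \<longleftrightarrow> X \<subseteq> verts G \<and> (\<forall>u\<in>X. \<forall>v\<in>X. \<not> u \<rightarrow>\<^bsub>G\<^esub> v)"

text \<open>
  \<open>painter_holds G U k\<close>: in the slow-coloring game on \<open>G\<close> with set \<open>U\<close> of uncolored vertices,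
  Painter has a strategy that ends the game with Lister scoring at most \<open>k\<close> from now on.
  \<open>lister_forces G U k\<close>: Lister has a strategy for scoring at least \<open>k\<close> from now on.
  Painter may color the empty set; as every marked set is nonempty, a game that never ends has
  infinite score.  In \<open>lister_forces\<close>, truncated subtraction is intended: once \<open>k\<close> points are
  scored, nothing remains to be forced.
\<close>

inductive painter_holds :: "('a, 'b) pre_digraph \<Rightarrow> 'a set \<Rightarrow> nat \<Rightarrow> bool" for G where
  "(\<And>M. M \<subseteq> U \<Longrightarrow> M \<noteq> {} \<Longrightarrow>
      card M \<le> k \<and> (\<exists>X. X \<subseteq> M \<and> indep_set G X \<and> painter_holds G (U - X) (k - card M))) \<Longrightarrow>
   painter_holds G U k"

inductive lister_forces :: "('a, 'b) pre_digraph \<Rightarrow> 'a set \<Rightarrow> nat \<Rightarrow> bool" for G where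
  zero: "lister_forces G U 0"
| mark: "M \<subseteq> U \<Longrightarrow> M \<noteq> {} \<Longrightarrow>
      (\<And>X. X \<subseteq> M \<Longrightarrow> indep_set G X \<Longrightarrow> lister_forces G (U - X) (k - card M)) \<Longrightarrow>
   lister_forces G U k"

text \<open>
  The score under optimal play by both players; it exists and is unique by
  \<open>sum_color_cost_ex1\<close> below.
\<close>

definition sum_color_cost :: "('a, 'b) pre_digraph \<Rightarrow> nat" where
  "sum_color_cost G = (THE s. painter_holds G (verts G) s \<and> lister_forces G (verts G) s)"

lemma painter_holds_iff:
  "painter_holds G U k \<longleftrightarrow>
    (\<forall>M. M \<subseteq> U \<longrightarrow> M \<noteq> {} \<longrightarrow>
      card M \<le> k \<and> (\<exists>X. X \<subseteq> M \<and> indep_set G X \<and> painter_holds G (U - X) (k - card M)))"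
  by (subst painter_holds.simps) auto

lemma lister_forces_iff:
  "lister_forces G U k \<longleftrightarrow> k = 0 \<or>
    (\<exists>M. M \<subseteq> U \<and> M \<noteq> {} \<and>
      (\<forall>X. X \<subseteq> M \<longrightarrow> indep_set G X \<longrightarrow> lister_forces G (U - X) (k - card M)))"
  by (subst lister_forces.simps) auto

lemma lister_forces_mono:
  "lister_forces G U k \<Longrightarrow> j \<le> k \<Longrightarrow> lister_forces G U j"
proof (induction arbitrary: j rule: lister_forces.induct)
  case (zero U)
  then show ?case by (auto intro: lister_forces.zero)
next
  case (mark M U k)
  show ?case
    by (rule lister_forces.mark[OF mark(1,2)]) (use mark in \<open>auto intro: diff_le_mono\<close>)
qed

lemma slow_coloring_determined:
  assumes "finite U"
  shows "\<not> painter_holds G U k \<longleftrightarrow> lister_forces G U (Suc k)"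
  using assms
proof (induction k arbitrary: U rule: less_induct)
  case (less k)
  have *: "\<not> (card M \<le> k \<and> (\<exists>X. X \<subseteq> M \<and> indep_set G X \<and> painter_holds G (U - X) (k - card M)))
      \<longleftrightarrow> (\<forall>X. X \<subseteq> M \<longrightarrow> indep_set G X \<longrightarrow> lister_forces G (U - X) (Suc k - card M))"
    if M: "M \<subseteq> U" "M \<noteq> {}" for M
  proof (cases "card M \<le> k")
    case True
    have "card M > 0"
      using M less.prems by (auto simp: card_gt_0_iff intro: finite_subset)
    then have "\<not> painter_holds G (U - X) (k - card M) \<longleftrightarrow>
        lister_forces G (U - X) (Suc k - card M)" for X
      using less.IH[of "k - card M" "U - X"] less.prems True by (simp add: Suc_diff_le)
    then show ?thesis using True by blast
  next
    case False
    then show ?thesis by (auto intro: lister_forces.zero)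
  qed
  show ?case
    unfolding painter_holds_iff[of G U k] lister_forces_iff[of G U "Suc k"]
    using * by (simp only: not_all not_imp nat.distinct simp_thms conj_assoc[symmetric])
      (meson *)
qed

lemma painter_holds_square:
  assumes "loopfree_digraph G" "finite U" "U \<subseteq> verts G"
  shows "painter_holds G U (card U * card U)"
  using assms(2,3)
proof (induction "card U" arbitrary: U rule: less_induct)
  case less
  have mono: "painter_holds G W k" if "painter_holds G W j" "j \<le> k" "finite W" for W j k
    using that slow_coloring_determined[of W G] lister_forces_mono[of G W "Suc k" "Suc j"] by auto
  show ?case
  proof (rule painter_holds.intros)
    fix M assume M: "M \<subseteq> U" "M \<noteq> {}"
    then obtain x where x: "x \<in> M" by blast
    have cM: "card M \<le> card U" using M less.prems by (simp add: card_mono)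
    have cU: "card U > 0" using M less.prems by (auto simp: card_gt_0_iff)
    have cx: "card (U - {x}) = card U - 1" using x M by auto
    obtain n where n: "card U = Suc n" using cU by (cases "card U") auto
    have "indep_set G {x}"
      using x M less.prems loopfree_digraph.adj_not_same[OF assms(1)]
      by (auto simp: indep_set_def)
    moreover have "painter_holds G (U - {x}) (card U * card U - card M)"
    proof (rule mono)
      show "painter_holds G (U - {x}) (card (U - {x}) * card (U - {x}))"
        by (rule less.hyps) (use less.prems cU cx in auto)
      show "card (U - {x}) * card (U - {x}) \<le> card U * card U - card M"
        using cM by (simp add: cx n)
    qed (use less.prems in simp)
    moreover have "card M \<le> card U * card U" using cM n by simp
    ultimately show "card M \<le> card U * card U \<and>
        (\<exists>X. X \<subseteq> M \<and> indep_set G X \<and> painter_holds G (U - X) (card U * card U - card M))"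
      using x by blast
  qed
qed

lemma sum_color_cost_ex1:
  assumes "graph G"
  shows "\<exists>!s. painter_holds G (verts G) s \<and> lister_forces G (verts G) s"
proof -
  interpret graph G by fact
  define s where "s = (LEAST k. painter_holds G (verts G) k)"
  have "painter_holds G (verts G) (card (verts G) * card (verts G))"
    by (rule painter_holds_square) (auto intro: loopfree_digraph_axioms)
  then have s: "painter_holds G (verts G) s"
    unfolding s_def by (rule LeastI)
  have "lister_forces G (verts G) s"
  proof (cases s)
    case (Suc k)
    then have "\<not> painter_holds G (verts G) k"
      unfolding s_def by (metis lessI not_less_Least)
    then show ?thesis using Suc slow_coloring_determined[OF finite_verts, of G k] by simp
  qed (auto intro: lister_forces.zero)
  moreover have "a \<le> b" if "lister_forces G (verts G) a" "painter_holds G (verts G) b" for a b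
    using that slow_coloring_determined[OF finite_verts, of G b]
      lister_forces_mono[of G "verts G" a "Suc b"] by (cases "a \<le> b") auto
  ultimately show ?thesis using s by (metis order_antisym)
qed

lemma sum_color_cost_optimal:
  assumes "graph G"
  shows "painter_holds G (verts G) (sum_color_cost G)"
    and "lister_forces G (verts G) (sum_color_cost G)"
  using theI'[OF sum_color_cost_ex1[OF assms]] unfolding sum_color_cost_def by auto

lemma lister_forces_iff_le_sum_color_cost:
  assumes "graph G"
  shows "lister_forces G (verts G) k \<longleftrightarrow> k \<le> sum_color_cost G"
proof -
  interpret graph G by fact
  show ?thesis
    using sum_color_cost_optimal[OF assms] slow_coloring_determined[OF finite_verts, of G]
      lister_forces_mono by (metis not_less_eq_eq)
qed

lemma painter_holds_iff_sum_color_cost_le: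
  assumes "graph G"
  shows "painter_holds G (verts G) k \<longleftrightarrow> sum_color_cost G \<le> k"
proof -
  interpret graph G by fact
  show ?thesis
    using slow_coloring_determined[OF finite_verts, of G k]
      lister_forces_iff_le_sum_color_cost[OF assms, of "Suc k"] by auto
qed

end

theory Submission
  imports Defs
begin

text \<open>
  On a forest, Painter keeps twice the remaining score at most \<open>3|U| - o(U)\<close>, where \<open>o(U)\<close>
  is the number of odd components of the uncolored set \<open>U\<close>: for every marked set \<open>M\<close>
  there is an independent \<open>X \<subseteq> M\<close> with \<open>3|X| + o(U - X) \<ge> 2|M| + o(U)\<close>.  On a tree, both
  sides have the same parity, so \<open>3|X| + o(U - X) \<ge> 2|M|\<close> suffices.  Root the tree at \<open>r\<close>,
  let \<open>c\<close> be the best value of \<open>3|X| + o(U - X) - 2|M|\<close> with \<open>r \<in> X\<close>, and let \<open>k\<close> be the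
  best value with \<open>r \<notin> X\<close>, not counting the component of \<open>r\<close>.  Then \<open>k \<ge> 0\<close> if \<open>r\<close> is
  unmarked and \<open>c + k \<ge> -1\<close> if \<open>r\<close> is marked; both are preserved when a rooted tree is attached
  to \<open>r\<close> by an edge.

  For a partition into classes \<open>V i\<close> on which Painter can hold the score to \<open>w i * |V i|\<close>,
  Painter always answers in the class maximizing \<open>|M \<inter> V i| / w i\<close>.  The potential
  \<open>(\<Sum>i. w i) * (\<Sum>i. k i / w i)\<close>, where \<open>k i\<close> is the score still conceded on \<open>V i\<close>, then
  drops by at least \<open>|M|\<close> per round.
\<close>

section \<open>Nonadjacent sets and partitions into nonadjacent parts\<close>

definition separated :: "('a, 'b) pre_digraph \<Rightarrow> 'a set \<Rightarrow> 'a set \<Rightarrow> bool" where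
  "separated G A B \<longleftrightarrow> (\<forall>a\<in>A. \<forall>b\<in>B. \<not> a \<rightarrow>\<^bsub>G\<^esub> b \<and> \<not> b \<rightarrow>\<^bsub>G\<^esub> a)"

lemma separated_Un_left: "separated G (A \<union> B) C \<longleftrightarrow> separated G A C \<and> separated G B C"
  by (auto simp: separated_def)

lemma separated_Un_right: "separated G A (B \<union> C) \<longleftrightarrow> separated G A B \<and> separated G A C"
  by (auto simp: separated_def)

lemma separated_mono: "separated G A B \<Longrightarrow> A' \<subseteq> A \<Longrightarrow> B' \<subseteq> B \<Longrightarrow> separated G A' B'"
  by (auto simp: separated_def)

lemma indep_set_empty: "indep_set G {}"
  by (simp add: indep_set_def)

lemma indep_set_subset: "indep_set G X \<Longrightarrow> Y \<subseteq> X \<Longrightarrow> indep_set G Y"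
  by (auto simp: indep_set_def)

lemma indep_set_Un:
  assumes "indep_set G X" "indep_set G Y" "separated G X Y"
  shows "indep_set G (X \<union> Y)"
  using assms by (auto simp: indep_set_def separated_def)

text \<open>
  \<open>odd_split G S c\<close>: \<open>S\<close> has a partition into pairwise nonadjacent parts, exactly \<open>c\<close> of them of
  odd size.  The parts need not be connected, so \<open>c\<close> is a lower bound for the number of odd
  components.
\<close>

inductive odd_split :: "('a, 'b) pre_digraph \<Rightarrow> 'a set \<Rightarrow> nat \<Rightarrow> bool" for G where
  empty: "odd_split G {} 0"
| part: "odd_split G S c \<Longrightarrow> finite A \<Longrightarrow> A \<inter> S = {} \<Longrightarrow> separated G A S \<Longrightarrow>
    odd_split G (A \<union> S) (card A mod 2 + c)"

lemma odd_split_finite: "odd_split G S c \<Longrightarrow> finite S"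
  by (induction rule: odd_split.induct) auto

lemma odd_split_parity: "odd_split G S c \<Longrightarrow> even (c + card S)"
proof (induction rule: odd_split.induct)
  case (part S c A)
  have "card (A \<union> S) = card A + card S"
    using part odd_split_finite by (intro card_Un_disjoint) auto
  then show ?case using part.IH by presburger
qed simp

lemma odd_split_le_card: "odd_split G S c \<Longrightarrow> c \<le> card S"
proof (induction rule: odd_split.induct)
  case (part S c A)
  have "card A mod 2 \<le> card A" by simp
  then show ?case using part odd_split_finite[OF part.hyps(1)] by (simp add: card_Un_disjoint)
qed simp

lemma odd_split_single_part: "finite A \<Longrightarrow> odd_split G A (card A mod 2)"
  using odd_split.part[OF odd_split.empty, of A G] by (simp add: separated_def)

lemma odd_split_Un:
  assumes "odd_split G S c" "odd_split G T d" "S \<inter> T = {}" "separated G S T"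
  shows "odd_split G (S \<union> T) (c + d)"
  using assms
proof (induction rule: odd_split.induct)
  case (part S c A)
  have "odd_split G (A \<union> (S \<union> T)) (card A mod 2 + (c + d))"
    by (rule odd_split.part) (use part in \<open>auto simp: separated_Un_left separated_Un_right\<close>)
  then show ?case by (simp add: Un_assoc add.assoc)
qed simp

section \<open>Values of responses on rooted sets, and joining two such sets\<close>

text \<open>For the potential \<open>3 * card U - c\<close>, with \<open>c\<close> the odd parts
  counted in \<open>U\<close>, coloring \<open>X\<close> after marking \<open>M\<close> costs at
  least \<open>2 * card M\<close> exactly when this value, taken with the new count, is at least the
  old count.\<close>

definition response_value :: "'a set \<Rightarrow> 'a set \<Rightarrow> nat \<Rightarrow> int" where
  "response_value M X c = 3 * int (card X) + int c - 2 * int (card M)"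

definition colors_root ::
    "('a, 'b) pre_digraph \<Rightarrow> 'a set \<Rightarrow> 'a set \<Rightarrow> 'a \<Rightarrow> int \<Rightarrow> bool" where
  "colors_root G M S r v \<longleftrightarrow> (\<exists>X c. r \<in> X \<and> X \<subseteq> M \<inter> S \<and> indep_set G X \<and>
     odd_split G (S - X) c \<and> v = response_value (M \<inter> S) X c)"

text \<open>Here \<open>R\<close> is the part of the uncolored set that contains the root; it is not yet counted,
  since it may still grow when \<open>S\<close> is attached to a larger tree at the root.\<close>

definition keeps_root ::
    "('a, 'b) pre_digraph \<Rightarrow> 'a set \<Rightarrow> 'a set \<Rightarrow> 'a \<Rightarrow> int \<Rightarrow> bool" where
  "keeps_root G M S r v \<longleftrightarrow> (\<exists>X R c. r \<in> R \<and> R \<subseteq> S - X \<and> X \<subseteq> M \<inter> S \<and> indep_set G X \<and>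
     separated G R (S - X - R) \<and> odd_split G (S - X - R) c \<and> v = response_value (M \<inter> S) X c)"

definition joined_at :: "('a, 'b) pre_digraph \<Rightarrow> 'a set \<Rightarrow> 'a \<Rightarrow> 'a set \<Rightarrow> 'a \<Rightarrow> bool" where
  "joined_at G A r B s \<longleftrightarrow> finite A \<and> finite B \<and> A \<inter> B = {} \<and>
     (\<forall>a\<in>A. \<forall>b\<in>B. a \<rightarrow>\<^bsub>G\<^esub> b \<or> b \<rightarrow>\<^bsub>G\<^esub> a \<longrightarrow> a = r \<and> b = s)"

lemma joined_at_separated:
  assumes "joined_at G A r B s" "A' \<subseteq> A" "B' \<subseteq> B" "r \<notin> A' \<or> s \<notin> B'"
  shows "separated G A' B'" "separated G B' A'"
  using assms unfolding joined_at_def separated_def by blast+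

lemma response_value_Un:
  assumes "finite A" "finite B" "A \<inter> B = {}" "X \<subseteq> M \<inter> A" "Y \<subseteq> M \<inter> B"
  shows "response_value (M \<inter> (A \<union> B)) (X \<union> Y) (c + d) =
    response_value (M \<inter> A) X c + response_value (M \<inter> B) Y d"
proof -
  have "card (M \<inter> (A \<union> B)) = card (M \<inter> A) + card (M \<inter> B)"
    using assms by (subst Int_Un_distrib, intro card_Un_disjoint) auto
  moreover have "card (X \<union> Y) = card X + card Y"
    by (rule card_Un_disjoint) (use assms in \<open>auto intro: finite_subset\<close>)
  ultimately show ?thesis by (simp add: response_value_def)
qed

text \<open>The parts \<open>R\<close> and \<open>Q\<close> may be linked by the edge from
  \<open>r\<close> to \<open>s\<close>, so their union is the new root part. Neither was counted,
  hence the values add.\<close>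

lemma keeps_root_join_keeps:
  assumes j: "joined_at G A r B s" and "keeps_root G M A r v" "keeps_root G M B s w"
  shows "keeps_root G M (A \<union> B) r (v + w)"
proof -
  obtain X R c where 1: "r \<in> R" "R \<subseteq> A - X" "X \<subseteq> M \<inter> A" "indep_set G X"
     "separated G R (A - X - R)" "odd_split G (A - X - R) c" "v = response_value (M \<inter> A) X c"
    using assms(2) unfolding keeps_root_def by blast
  obtain Y Q d where 2: "s \<in> Q" "Q \<subseteq> B - Y" "Y \<subseteq> M \<inter> B" "indep_set G Y"
     "separated G Q (B - Y - Q)" "odd_split G (B - Y - Q) d" "w = response_value (M \<inter> B) Y d"
    using assms(3) unfolding keeps_root_def by blast
  have AB: "finite A" "finite B" "A \<inter> B = {}" using j by (auto simp: joined_at_def)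
  have rest: "A \<union> B - (X \<union> Y) - (R \<union> Q) = (A - X - R) \<union> (B - Y - Q)"
    using 1(2,3) 2(2,3) AB(3) by blast
  have "separated G X Y" "separated G (A - X - R) (B - Y - Q)"
    "separated G R (B - Y - Q)" "separated G Q (A - X - R)"
    by (rule joined_at_separated[OF j]; use 1(1,2,3) 2(1,2,3) in blast)+
  then have "indep_set G (X \<union> Y)"
    "odd_split G (A \<union> B - (X \<union> Y) - (R \<union> Q)) (c + d)"
    "separated G (R \<union> Q) (A \<union> B - (X \<union> Y) - (R \<union> Q))"
    unfolding rest using 1 2 AB(3)
    by (auto intro!: indep_set_Un odd_split_Un simp: separated_Un_left separated_Un_right)
  moreover have "r \<in> R \<union> Q" "R \<union> Q \<subseteq> A \<union> B - (X \<union> Y)" "X \<union> Y \<subseteq> M \<inter> (A \<union> B)"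
    using 1(1,2,3) 2(2,3) AB(3) by blast+
  ultimately show ?thesis
    unfolding keeps_root_def 1(7) 2(7) response_value_Un[OF AB 1(3) 2(3), symmetric]
    by (intro exI[of _ "X \<union> Y"] exI[of _ "R \<union> Q"] exI[of _ "c + d"] conjI refl)
qed

text \<open>Coloring \<open>s\<close> removes the only possible link, so all parts left in
  \<open>B\<close> stay counted and \<open>R\<close> remains the root part.\<close>

lemma keeps_root_join_colors:
  assumes j: "joined_at G A r B s" and "keeps_root G M A r v" "colors_root G M B s w"
  shows "keeps_root G M (A \<union> B) r (v + w)"
proof -
  obtain X R c where 1: "r \<in> R" "R \<subseteq> A - X" "X \<subseteq> M \<inter> A" "indep_set G X"
     "separated G R (A - X - R)" "odd_split G (A - X - R) c" "v = response_value (M \<inter> A) X c"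
    using assms(2) unfolding keeps_root_def by blast
  obtain Y d where 2: "s \<in> Y" "Y \<subseteq> M \<inter> B" "indep_set G Y"
     "odd_split G (B - Y) d" "w = response_value (M \<inter> B) Y d"
    using assms(3) unfolding colors_root_def by blast
  have AB: "finite A" "finite B" "A \<inter> B = {}" using j by (auto simp: joined_at_def)
  have rest: "A \<union> B - (X \<union> Y) - R = (A - X - R) \<union> (B - Y)"
    using 1(2,3) 2(2) AB(3) by blast
  have "separated G X Y" "separated G (A - X - R) (B - Y)" "separated G R (B - Y)"
    by (rule joined_at_separated[OF j]; use 1(1,2,3) 2(1,2) in blast)+
  then have "indep_set G (X \<union> Y)"
    "odd_split G (A \<union> B - (X \<union> Y) - R) (c + d)"
    "separated G R (A \<union> B - (X \<union> Y) - R)"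
    unfolding rest using 1 2 AB(3)
    by (auto intro!: indep_set_Un odd_split_Un simp: separated_Un_right)
  moreover have "R \<subseteq> A \<union> B - (X \<union> Y)" "X \<union> Y \<subseteq> M \<inter> (A \<union> B)"
    using 1(1,2,3) 2(2) AB(3) by blast+
  ultimately show ?thesis
    unfolding keeps_root_def 1(7) 2(5) response_value_Un[OF AB 1(3) 2(2), symmetric]
    using 1(1) by (intro exI[of _ "X \<union> Y"] exI[of _ R] exI[of _ "c + d"] conjI refl)
qed

text \<open>Modulo 2, \<open>3 * card X + c\<close> is \<open>card X + card (S - X)\<close>, and the
  term in \<open>M\<close> is even.\<close>

lemma odd_split_response_parity:
  assumes "finite S" "X \<subseteq> S" "odd_split G (S - X) c"
  shows "even (response_value M X c + int (card S))"
proof -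
  have "card S = card X + card (S - X)"
    using assms by (metis card_Diff_subset card_mono finite_subset le_add_diff_inverse)
  moreover have "even (c + card (S - X))" by (rule odd_split_parity[OF assms(3)])
  ultimately show ?thesis unfolding response_value_def by presburger
qed

lemma colors_root_parity:
  "colors_root G M S r v \<Longrightarrow> finite S \<Longrightarrow> even (v + int (card S))"
  unfolding colors_root_def using odd_split_response_parity by blast

text \<open>Once nothing more is attached at \<open>r\<close>, the root part can be counted as well,
  which adds 0 or 1.\<close>

lemma keeps_root_response:
  assumes "keeps_root G M S r v" "finite S"
  obtains X c where "r \<notin> X" "X \<subseteq> M \<inter> S" "indep_set G X" "odd_split G (S - X) c"
    "v \<le> response_value (M \<inter> S) X c"
proof -
  obtain X R c where 1: "r \<in> R" "R \<subseteq> S - X" "X \<subseteq> M \<inter> S" "indep_set G X"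
     "separated G R (S - X - R)" "odd_split G (S - X - R) c" "v = response_value (M \<inter> S) X c"
    using assms(1) unfolding keeps_root_def by blast
  have "finite R" using 1(2) assms(2) finite_subset by blast
  then have "odd_split G (R \<union> (S - X - R)) (card R mod 2 + c)"
    using 1 by (intro odd_split.part) auto
  moreover have "R \<union> (S - X - R) = S - X" using 1(2) by blast
  ultimately have "odd_split G (S - X) (card R mod 2 + c)" by simp
  moreover have "v \<le> response_value (M \<inter> S) X (card R mod 2 + c)"
    using 1(7) by (simp add: response_value_def)
  ultimately show thesis using that 1 by blast
qed

text \<open>Since \<open>r\<close> is colored, no part of \<open>B\<close> can merge with one of
  \<open>A\<close>, so the root part of \<open>B\<close> is counted too. The resulting
  \<open>w'\<close> has the parity of \<open>card B\<close>, which is what the induction over rooted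
  sets exploits.\<close>

lemma colors_root_join:
  assumes j: "joined_at G A r B s" and "colors_root G M A r v" "keeps_root G M B s w"
  shows "\<exists>w'\<ge>w. even (w' + int (card B)) \<and> colors_root G M (A \<union> B) r (v + w')"
proof -
  have AB: "finite A" "finite B" "A \<inter> B = {}" using j by (auto simp: joined_at_def)
  obtain X c where 1: "r \<in> X" "X \<subseteq> M \<inter> A" "indep_set G X"
     "odd_split G (A - X) c" "v = response_value (M \<inter> A) X c"
    using assms(2) unfolding colors_root_def by blast
  obtain Y d where 2: "s \<notin> Y" "Y \<subseteq> M \<inter> B" "indep_set G Y" "odd_split G (B - Y) d"
    "w \<le> response_value (M \<inter> B) Y d"
    using keeps_root_response[OF assms(3) AB(2)] by blast
  have rest: "A \<union> B - (X \<union> Y) = (A - X) \<union> (B - Y)"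
    using 1(2) 2(2) AB(3) by blast
  have "separated G X Y" "separated G (A - X) (B - Y)"
    by (rule joined_at_separated[OF j]; use 1(1,2,3) 2(1,2) in blast)+
  then have "indep_set G (X \<union> Y)" "odd_split G (A \<union> B - (X \<union> Y)) (c + d)"
    unfolding rest using 1 2 AB(3) by (auto intro!: indep_set_Un odd_split_Un)
  moreover have "X \<union> Y \<subseteq> M \<inter> (A \<union> B)" using 1(2) 2(2) by blast
  ultimately have "colors_root G M (A \<union> B) r (v + response_value (M \<inter> B) Y d)"
    unfolding colors_root_def 1(5) response_value_Un[OF AB 1(2) 2(2), symmetric]
    using 1(1) by (intro exI[of _ "X \<union> Y"] exI[of _ "c + d"] conjI refl UnI1)
  moreover have "even (response_value (M \<inter> B) Y d + int (card B))"
    using odd_split_response_parity 2 AB by blast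
  ultimately show ?thesis using 2(5) by blast
qed

section \<open>Splitting a forest along an edge at a given root\<close>

text \<open>Quantifying over all subsets makes the property hereditary, as needed for the induction
  and for the sets left uncolored during play.\<close>

definition edge_splittable :: "('a, 'b) pre_digraph \<Rightarrow> 'a set \<Rightarrow> bool" where
  "edge_splittable G S \<longleftrightarrow> (\<forall>T\<subseteq>S. \<forall>r\<in>T. T \<noteq> {r} \<longrightarrow>
     (\<exists>A B s. T = A \<union> B \<and> r \<in> A \<and> s \<in> B \<and> joined_at G A r B s))"

lemma edge_splittable_subset: "edge_splittable G S \<Longrightarrow> T \<subseteq> S \<Longrightarrow> edge_splittable G T"
  unfolding edge_splittable_def by (meson subset_trans)

text \<open>Let \<open>B\<close> be a component of \<open>T - {r}\<close>. Two neighbors of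
  \<open>r\<close> in \<open>B\<close>, joined by a path in \<open>B\<close>, would close a cycle
  through \<open>r\<close>; so at most one edge leaves \<open>B\<close> within
  \<open>T\<close>.\<close>

lemma (in graph) undirected_forest_edge_splittable:
  assumes "undirected_forest (G \<restriction> F)" "F \<subseteq> verts G"
  shows "edge_splittable G F"
  unfolding edge_splittable_def
proof (intro allI impI ballI)
  fix T r assume T: "T \<subseteq> F" "r \<in> T" "T \<noteq> {r}"
  have T_verts: "T \<subseteq> verts G" using T assms by blast
  then have fin: "finite T" using finite_verts finite_subset by blast
  define H where "H = G \<restriction> (T - {r})"
  have verts_H: "verts H = T - {r}" by (simp add: H_def)
  interpret H: wf_digraph H unfolding H_def using T_verts by blast
  interpret GF: wf_digraph "G \<restriction> F" using assms(2) by blast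
  have adj_sym: "a \<rightarrow>\<^bsub>G\<^esub> b \<Longrightarrow> b \<rightarrow>\<^bsub>G\<^esub> a" for a b
    using sym_arcs by (auto simp: symmetric_def sym_def)
  have adj_H: "a \<rightarrow>\<^bsub>H\<^esub> b" if "a \<rightarrow>\<^bsub>G\<^esub> b" "a \<in> T - {r}" "b \<in> T - {r}" for a b
    using that by (auto simp: H_def arcs_ends_def arc_to_ends_def)
  have sym_H: "symmetric H"
    unfolding symmetric_def
  proof (rule symI)
    fix a b assume ab: "a \<rightarrow>\<^bsub>H\<^esub> b"
    then have "a \<rightarrow>\<^bsub>G\<^esub> b" "a \<in> T - {r}" "b \<in> T - {r}"
      by (auto simp: H_def arcs_ends_def arc_to_ends_def)
    then show "b \<rightarrow>\<^bsub>H\<^esub> a" using adj_H[OF adj_sym] by simp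
  qed
  have unique: "b1 = b2"
    if b: "b1 \<rightarrow>\<^sup>*\<^bsub>H\<^esub> b2" "r \<rightarrow>\<^bsub>G\<^esub> b1" "r \<rightarrow>\<^bsub>G\<^esub> b2" for b1 b2
  proof (rule ccontr)
    assume ne: "b1 \<noteq> b2"
    obtain p where p: "H.apath b1 p b2" using b(1) H.reachable_apath by blast
    have "p \<noteq> []" using p ne by (auto simp: H.apath_Nil_iff)
    have pw: "H.awalk b1 p b2" "distinct (H.awalk_verts b1 p)"
      using p by (auto simp: H.apath_def)
    have bT: "b1 \<in> T - {r}" "b2 \<in> T - {r}"
      using H.awalk_hd_in_verts[OF pw(1)] H.awalk_last_in_verts[OF pw(1)] verts_H by auto
    have pv: "set (H.awalk_verts b1 p) \<subseteq> T - {r}"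
      using pw(1) verts_H by (auto elim!: H.awalkE)
    \<comment> \<open>Both subgraphs share the tail and head functions, so the path in
      \<open>H\<close> is also a walk in \<open>G \<restriction> F\<close>.\<close>
    have comp: "compatible H (G \<restriction> F)" by (simp add: compatible_def H_def)
    have ver: "GF.awalk_verts = H.awalk_verts"
      using comp by (simp add: compatible_awalk_verts)
    have cas: "GF.cas = H.cas" using comp by (simp add: compatible_cas)
    have "arcs H \<subseteq> arcs (G \<restriction> F)" using T by (auto simp: H_def)
    then have GFw: "GF.awalk b1 p b2"
      using pw(1) bT T unfolding GF.awalk_def H.awalk_def cas by auto
    obtain e where e: "e \<in> arcs G" "tail G e = r" "head G e = b1"
      using b(2) by (auto simp: arcs_ends_def arc_to_ends_def)
    obtain f where f: "f \<in> arcs G" "tail G f = b2" "head G f = r"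
      using adj_sym[OF b(3)] by (auto simp: arcs_ends_def arc_to_ends_def)
    have ef: "e \<in> arcs (G \<restriction> F)" "f \<in> arcs (G \<restriction> F)" using e f bT T by auto
    have "GF.awalk b2 [f] r" using ef f by (auto simp: GF.awalk_simps)
    then have pf: "GF.awalk b1 (p @ [f]) r" using GFw by (rule GF.awalk_appendI[rotated])
    have "GF.awalk r (e # p @ [f]) r"
      using pf ef e T by (auto simp: GF.awalk_Cons_iff)
    moreover have "GF.awalk_verts b1 (p @ [f]) = H.awalk_verts b1 p @ [r]"
      using GF.awalk_verts_append[OF pf] f by (simp add: ver[symmetric])
    then have "distinct (tl (GF.awalk_verts r (e # p @ [f])))"
      using pw(2) pv e by auto
    ultimately have "GF.cycle (e # p @ [f])" unfolding GF.cycle_def by blast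
    \<comment> \<open>Here \<open>b1 \<noteq> b2\<close> matters: otherwise the closed walk would
      only traverse one edge back and forth.\<close>
    moreover have "3 \<le> length (e # p @ [f])" using \<open>p \<noteq> []\<close> by (cases p) auto
    ultimately show False using assms(1) unfolding undirected_forest_def by blast
  qed
  obtain s0 where s0: "s0 \<in> T - {r}" using T by blast
  define B where "B = {v. s0 \<rightarrow>\<^sup>*\<^bsub>H\<^esub> v}"
  have B: "B \<subseteq> T - {r}" "s0 \<in> B"
    using H.reachable_in_verts s0 verts_H by (auto simp: B_def)
  have reach: "b1 \<rightarrow>\<^sup>*\<^bsub>H\<^esub> b2" if "b1 \<in> B" "b2 \<in> B" for b1 b2
    using that symmetric_reachable[OF sym_H] H.reachable_trans unfolding B_def by blast
  \<comment> \<open>If \<open>r\<close> has no neighbor in \<open>B\<close>, any element of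
    \<open>B\<close> serves as \<open>s\<close>.\<close>
  obtain s where s: "s \<in> B" "\<And>b. b \<in> B \<Longrightarrow> r \<rightarrow>\<^bsub>G\<^esub> b \<Longrightarrow> b = s"
    using B(2) unique reach by metis
  have "a = r \<and> b = s" if ab: "a \<in> T - B" "b \<in> B" "a \<rightarrow>\<^bsub>G\<^esub> b \<or> b \<rightarrow>\<^bsub>G\<^esub> a" for a b
  proof -
    have adj: "a \<rightarrow>\<^bsub>G\<^esub> b" "b \<rightarrow>\<^bsub>G\<^esub> a" using ab adj_sym by blast+
    have "a = r"
    proof (rule ccontr)
      assume "a \<noteq> r"
      then have "b \<rightarrow>\<^bsub>H\<^esub> a" using adj ab B by (intro adj_H) auto
      then have "a \<in> B" using ab(2) H.reachable_adj_trans unfolding B_def by blast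
      then show False using ab by blast
    qed
    then show ?thesis using s adj ab by blast
  qed
  then have "joined_at G (T - B) r B s"
    using fin B finite_subset[of B T] unfolding joined_at_def by auto
  moreover have "T = (T - B) \<union> B" "r \<in> T - B" using B T by auto
  ultimately show "\<exists>A B s. T = A \<union> B \<and> r \<in> A \<and> s \<in> B \<and> joined_at G A r B s"
    using s(1) by blast
qed

section \<open>Painter's responses on a forest\<close>

text \<open>Passing from \<open>A\<close> to \<open>A \<union> B\<close> adds some
  \<open>x \<ge> 0\<close> to the value that keeps \<open>r\<close> and some \<open>y'\<close> to
  the value that colors \<open>r\<close>. Parity gives \<open>x + y' \<ge> 0\<close>, so both bounds
  persist.\<close>

lemma rooted_response:
  assumes "edge_splittable G S" "loopfree_digraph G" "finite S" "S \<subseteq> verts G" "r \<in> S"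
  shows "(r \<notin> M \<longrightarrow> (\<exists>v\<ge>0. keeps_root G M S r v)) \<and>
    (r \<in> M \<longrightarrow> (\<exists>v w. colors_root G M S r v \<and> keeps_root G M S r w \<and> v + w \<ge> -1))"
  using assms(1,3-)
proof (induction "card S" arbitrary: S r rule: less_induct)
  case less
  show ?case
  proof (cases "S = {r}")
    \<comment> \<open>A marked vertex gives 3 - 2 = 1 if colored and -2 if kept, with sum -1; an
      unmarked one gives 0 if kept.\<close>
    case True
    have sep: "separated G {r} {}" by (simp add: separated_def)
    have keep: "keeps_root G M S r (- 2 * int (card (M \<inter> S)))"
      unfolding keeps_root_def True
      by (rule exI[of _ "{}"], rule exI[of _ "{r}"], rule exI[of _ 0])
        (auto simp: sep indep_set_empty odd_split.empty response_value_def)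
    have color: "colors_root G M S r 1" if "r \<in> M"
    proof -
      have "indep_set G {r}"
        using less.prems loopfree_digraph.adj_not_same[OF assms(2)]
        by (auto simp: indep_set_def)
      then show ?thesis
        unfolding colors_root_def True using that
        by (intro exI[of _ "{r}"] exI[of _ 0]) (auto simp: odd_split.empty response_value_def)
    qed
    show ?thesis
    proof (cases "r \<in> M")
      case rM: True
      then have "card (M \<inter> S) = 1" using True by auto
      then have "keeps_root G M S r (-2)" using keep by simp
      then show ?thesis using color rM by force
    next
      case False
      then have "M \<inter> S = {}" using True by auto
      then show ?thesis using keep False by auto
    qed
  next
    case False
    with less.prems have "\<exists>A B s. S = A \<union> B \<and> r \<in> A \<and> s \<in> B \<and> joined_at G A r B s"
      unfolding edge_splittable_def by simp
    then obtain A B s where S: "S = A \<union> B" "r \<in> A" "s \<in> B" and j: "joined_at G A r B s"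
      by (elim exE conjE)
    have fin: "finite A" "finite B" and AB: "A \<inter> B = {}" using j by (auto simp: joined_at_def)
    have "A \<subset> S" "B \<subset> S" using S AB by auto
    then have lt: "card A < card S" "card B < card S"
      using less.prems by (auto intro: psubset_card_mono)
    have es: "edge_splittable G A" "edge_splittable G B"
      using less.prems S edge_splittable_subset by blast+
    have ihA: "(r \<notin> M \<longrightarrow> (\<exists>v\<ge>0. keeps_root G M A r v)) \<and>
        (r \<in> M \<longrightarrow> (\<exists>v w. colors_root G M A r v \<and> keeps_root G M A r w \<and> v + w \<ge> -1))"
      by (rule less.hyps) (use lt es fin less.prems S in auto)
    have ihB: "(s \<notin> M \<longrightarrow> (\<exists>v\<ge>0. keeps_root G M B s v)) \<and>
        (s \<in> M \<longrightarrow> (\<exists>v w. colors_root G M B s v \<and> keeps_root G M B s w \<and> v + w \<ge> -1))"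
      by (rule less.hyps) (use lt es fin less.prems S in auto)
    \<comment> \<open>If \<open>r\<close> is kept, \<open>s\<close> may be kept or colored, and
      \<open>B\<close> contributes \<open>x\<close>. If \<open>r\<close> is colored,
      \<open>s\<close> is kept with value \<open>y\<close>, which becomes \<open>y'\<close> when the
      root part of \<open>B\<close> is counted.\<close>
    have B: "\<exists>x y. x \<ge> 0 \<and> (keeps_root G M B s x \<or> colors_root G M B s x) \<and>
        keeps_root G M B s y \<and> (\<forall>y'\<ge>y. even (y' + int (card B)) \<longrightarrow> x + y' \<ge> 0)"
    proof (cases "s \<in> M")
      case True
      then obtain v w where vw: "colors_root G M B s v" "keeps_root G M B s w" "v + w \<ge> -1"
        using ihB by blast
      have par: "even (v + int (card B))" using colors_root_parity[OF vw(1) fin(2)] .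
      have "max v w + y' \<ge> 0" if "y' \<ge> w" "even (y' + int (card B))" for y'
      proof -
        \<comment> \<open>Both summands have the parity of \<open>card B\<close>, which lifts the
          bound -1 to 0.\<close>
        have "even (v + y')" using par that(2) by presburger
        moreover have "v + y' \<ge> -1" using that vw(3) by linarith
        ultimately have "v + y' \<ge> 0" by presburger
        then show ?thesis by linarith
      qed
      moreover have "max v w \<ge> 0" using vw(3) by linarith
      moreover have "keeps_root G M B s (max v w) \<or> colors_root G M B s (max v w)"
        using vw by (auto simp: max_def)
      ultimately show ?thesis using vw(2)
        by (intro exI[of _ "max v w"] exI[of _ w] conjI allI impI) (assumption | linarith)+
    next
      case False
      then show ?thesis using ihB by force
    qed
    then obtain x y where xy: "x \<ge> 0" "keeps_root G M B s x \<or> colors_root G M B s x"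
      "keeps_root G M B s y" "\<forall>y'\<ge>y. even (y' + int (card B)) \<longrightarrow> x + y' \<ge> 0" by blast
    have keep: "keeps_root G M S r (w + x)" if "keeps_root G M A r w" for w
      unfolding S using xy(2) keeps_root_join_keeps[OF j that] keeps_root_join_colors[OF j that]
      by blast
    show ?thesis
    proof (cases "r \<in> M")
      case True
      then obtain v w where vw: "colors_root G M A r v" "keeps_root G M A r w" "v + w \<ge> -1"
        using ihA by blast
      obtain y' where y': "y' \<ge> y" "even (y' + int (card B))" "colors_root G M S r (v + y')"
        using colors_root_join[OF j vw(1) xy(3)] S by blast
      have "x + y' \<ge> 0" using xy(4) y' by blast
      then have "(v + y') + (w + x) \<ge> -1" using vw(3) by linarith
      then show ?thesis using True y'(3) keep[OF vw(2)] by blast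
    next
      case False
      then obtain w where "w \<ge> 0" "keeps_root G M A r w" using ihA by blast
      then show ?thesis using False keep xy(1) by (meson add_nonneg_nonneg)
    qed
  qed
qed

text \<open>By parity, a response that is good enough for an even set automatically gains the missing
  unit on an odd set.\<close>

lemma edge_splittable_response:
  assumes "edge_splittable G S" "loopfree_digraph G" "finite S" "S \<subseteq> verts G"
  shows "\<exists>X c. X \<subseteq> M \<inter> S \<and> indep_set G X \<and> odd_split G (S - X) c \<and>
    2 * card (M \<inter> S) + card S mod 2 \<le> 3 * card X + c"
proof (cases "S = {}")
  case True
  then show ?thesis using indep_set_empty odd_split.empty by fastforce
next
  case False
  then obtain r where r: "r \<in> S" by blast
  have "\<exists>v\<ge>0. keeps_root G M S r v \<or> colors_root G M S r v"
  proof (cases "r \<in> M")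
    case True
    then obtain v w where vw: "colors_root G M S r v" "keeps_root G M S r w" "v + w \<ge> -1"
      using rooted_response[OF assms r, of M] by blast
    \<comment> \<open>Two integers with sum at least -1 are not both negative.\<close>
    then have "v \<ge> 0 \<or> w \<ge> 0" by linarith
    then show ?thesis using vw by blast
  qed (use rooted_response[OF assms r, of M] in blast)
  then obtain v where v: "v \<ge> 0" "keeps_root G M S r v \<or> colors_root G M S r v" by blast
  obtain X c where X: "X \<subseteq> M \<inter> S" "indep_set G X" "odd_split G (S - X) c"
    "v \<le> response_value (M \<inter> S) X c"
    using v(2)
  proof
    assume "keeps_root G M S r v"
    then show thesis using keeps_root_response[OF _ assms(3)] that by metis
  next
    assume "colors_root G M S r v"
    then show thesis using that unfolding colors_root_def by (metis order_refl)
  qed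
  have "even (response_value (M \<inter> S) X c + int (card S))"
    by (rule odd_split_response_parity) (use X assms in auto)
  moreover have "response_value (M \<inter> S) X c \<ge> 0" using v X by linarith
  ultimately have "2 * card (M \<inter> S) + card S mod 2 \<le> 3 * card X + c"
    unfolding response_value_def by presburger
  then show ?thesis using X by blast
qed

text \<open>The parts are pairwise nonadjacent, so responses chosen separately in them unite to an
  independent set, and \<open>c\<close> is the sum of the parities of the part sizes.\<close>

lemma odd_split_response:
  assumes "odd_split G U c" "edge_splittable G U" "loopfree_digraph G" "U \<subseteq> verts G"
  shows "\<exists>X d. X \<subseteq> M \<inter> U \<and> indep_set G X \<and> odd_split G (U - X) d \<and>
    2 * card (M \<inter> U) + c \<le> 3 * card X + d"
  using assms
proof (induction rule: odd_split.induct)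
  case empty
  show ?case using indep_set_empty odd_split.empty by fastforce
next
  case (part S c A)
  have es: "edge_splittable G A" "edge_splittable G S"
    using part.prems(1) edge_splittable_subset by blast+
  obtain X d where X: "X \<subseteq> M \<inter> S" "indep_set G X" "odd_split G (S - X) d"
    "2 * card (M \<inter> S) + c \<le> 3 * card X + d"
    using part.IH es part.prems by auto
  obtain Y e where Y: "Y \<subseteq> M \<inter> A" "indep_set G Y" "odd_split G (A - Y) e"
    "2 * card (M \<inter> A) + card A mod 2 \<le> 3 * card Y + e"
    using edge_splittable_response[OF es(1) part.prems(2) part.hyps(2), of M] part.prems(3)
    by auto
  have finS: "finite S" using odd_split_finite part.hyps by blast
  have rest: "A \<union> S - (Y \<union> X) = (A - Y) \<union> (S - X)" using X(1) Y(1) part.hyps by blast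
  have "odd_split G (A \<union> S - (Y \<union> X)) (e + d)" unfolding rest
    by (rule odd_split_Un[OF Y(3) X(3)])
      (use part.hyps in \<open>auto intro: separated_mono[OF part.hyps(4)]\<close>)
  moreover have "indep_set G (Y \<union> X)"
    by (rule indep_set_Un[OF Y(2) X(2)]) (rule separated_mono[OF part.hyps(4)]; use X Y in blast)
  moreover have "card (M \<inter> (A \<union> S)) = card (M \<inter> A) + card (M \<inter> S)"
    using part.hyps finS by (subst Int_Un_distrib, intro card_Un_disjoint) auto
  moreover have "card (Y \<union> X) = card Y + card X"
    by (rule card_Un_disjoint)
      (use part.hyps finS X(1) Y(1) in \<open>auto intro: finite_subset\<close>)
  moreover have "Y \<union> X \<subseteq> M \<inter> (A \<union> S)" using X Y by blast
  ultimately show ?case using X(4) Y(4)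
    by (intro exI[of _ "Y \<union> X"] exI[of _ "e + d"]) auto
qed

section \<open>Strategies on forests and on independent sets\<close>

text \<open>Each response lowers \<open>3 * card U - c\<close> by at least twice the number of
  marked vertices, so its bound by \<open>2 * k\<close> survives every round.\<close>

lemma painter_holds_odd_split:
  assumes "loopfree_digraph G" "odd_split G U c" "edge_splittable G U" "U \<subseteq> verts G"
    "3 * card U \<le> 2 * k + c"
  shows "painter_holds G U k"
  using assms(2-)
proof (induction k arbitrary: U c rule: less_induct)
  case (less k)
  have fin: "finite U" using less.prems odd_split_finite by blast
  show ?case
  proof (rule painter_holds.intros)
    fix M assume M: "M \<subseteq> U" "M \<noteq> {}"
    obtain X d where X: "X \<subseteq> M \<inter> U" "indep_set G X" "odd_split G (U - X) d"
      "2 * card (M \<inter> U) + c \<le> 3 * card X + d"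
      using odd_split_response[OF less.prems(1,2) assms(1) less.prems(3)] by blast
    have MU: "M \<inter> U = M" using M by blast
    have cX: "card (U - X) = card U - card X" "card X \<le> card U"
      using X fin by (auto intro!: card_Diff_subset card_mono intro: finite_subset)
    have cM: "card M > 0" using M fin by (auto simp: card_gt_0_iff intro: finite_subset)
    \<comment> \<open>The new count is at most \<open>card (U - X)\<close>, so the new potential is
      nonnegative and \<open>2 * k\<close> covers \<open>2 * card M\<close>.\<close>
    have kM: "card M \<le> k"
      using odd_split_le_card[OF X(3)] X(4) less.prems(4) cX unfolding MU by linarith
    have "painter_holds G (U - X) (k - card M)"
    proof (rule less.IH)
      show "k - card M < k" using cM kM by linarith
      show "odd_split G (U - X) d" by fact
      show "edge_splittable G (U - X)" using less.prems edge_splittable_subset by blast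
      show "U - X \<subseteq> verts G" using less.prems by blast
      show "3 * card (U - X) \<le> 2 * (k - card M) + d"
        using X(4) less.prems(4) cX kM unfolding MU by linarith
    qed
    then show "card M \<le> k \<and>
        (\<exists>X\<subseteq>M. indep_set G X \<and> painter_holds G (U - X) (k - card M))"
      using kM X by blast
  qed
qed

text \<open>Play starts with \<open>F\<close> as a single part, whose parity makes up for the
  rounding in \<open>div\<close>.\<close>

lemma (in graph) painter_holds_forest:
  assumes "undirected_forest (G \<restriction> F)" "F \<subseteq> verts G"
  shows "painter_holds G F (3 * card F div 2)"
proof (rule painter_holds_odd_split)
  have "finite F" using assms finite_subset finite_verts by blast
  then show "odd_split G F (card F mod 2)" by (rule odd_split_single_part)
  show "3 * card F \<le> 2 * (3 * card F div 2) + card F mod 2" by presburger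
qed (use assms undirected_forest_edge_splittable loopfree_digraph_axioms in auto)

text \<open>Painter colors every marked vertex, so each vertex is scored once.\<close>

lemma painter_holds_indep_set:
  assumes "indep_set G I" "finite I"
  shows "painter_holds G I (card I)"
  using assms
proof (induction "card I" arbitrary: I rule: less_induct)
  case less
  show ?case
  proof (rule painter_holds.intros)
    fix M assume M: "M \<subseteq> I" "M \<noteq> {}"
    have fM: "finite M" using M less.prems finite_subset by blast
    have c: "card (I - M) = card I - card M" using M fM by (simp add: card_Diff_subset)
    have le: "card M \<le> card I" using M less.prems by (simp add: card_mono)
    have pos: "card M > 0" using M fM by (simp add: card_gt_0_iff)
    have "painter_holds G (I - M) (card (I - M))"
      using less.prems pos le c by (intro less.hyps) (auto intro: indep_set_subset)
    moreover have "indep_set G M" using less.prems M indep_set_subset by blast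
    ultimately show "card M \<le> card I \<and>
        (\<exists>X\<subseteq>M. indep_set G X \<and> painter_holds G (I - X) (card I - card M))"
      using c le by auto
  qed
qed

section \<open>Combining strategies on the classes of a partition\<close>

text \<open>In each round only the class of maximal ratio changes, both in its uncolored set and in
  its budget. The strict bound by \<open>K + 1\<close> adapts a real potential to an integer
  budget.\<close>

lemma painter_holds_weighted_union:
  fixes w :: "'i \<Rightarrow> real" and k :: "'i \<Rightarrow> nat"
  assumes "finite J" "\<And>i. i \<in> J \<Longrightarrow> w i > 0"
    and "disjoint_family_on U J" "\<And>i. i \<in> J \<Longrightarrow> finite (U i)"
    and "\<And>i. i \<in> J \<Longrightarrow> painter_holds G (U i) (k i)"
    and "sum w J * (\<Sum>i\<in>J. real (k i) / w i) < real K + 1"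
  shows "painter_holds G (\<Union>i\<in>J. U i) K"
  using assms(3-)
proof (induction K arbitrary: U k rule: less_induct)
  case (less K)
  note w = assms(2)
  show ?case
  proof (rule painter_holds.intros)
    fix M assume M: "M \<subseteq> (\<Union>i\<in>J. U i)" "M \<noteq> {}"
    define q where "q i = real (card (M \<inter> U i)) / w i" for i
    obtain i0 where i0: "i0 \<in> J" "M \<inter> U i0 \<noteq> {}" using M by blast
    have "finite (q ` J)" "q ` J \<noteq> {}" using assms(1) i0 by auto
    then have "Max (q ` J) \<in> q ` J" by (rule Max_in)
    then obtain i where i: "i \<in> J" "q i = Max (q ` J)" by auto
    have qmax: "q j \<le> q i" if "j \<in> J" for j using i that assms(1) by simp
    have "q i0 > 0" using i0 less.prems(2) w by (simp add: q_def card_gt_0_iff)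
    then have "q i > 0" using qmax[OF i0(1)] by linarith
    then have Mi: "M \<inter> U i \<noteq> {}" by (auto simp: q_def)
    have finM: "finite M" using M assms(1) less.prems(2) by (meson finite_UN finite_subset)
    have posM: "card M > 0" using M finM by (simp add: card_gt_0_iff)
    have "card M = card (\<Union>j\<in>J. M \<inter> U j)" using M by (intro arg_cong[where f=card]) blast
    also have "\<dots> = (\<Sum>j\<in>J. card (M \<inter> U j))"
      by (rule card_UN_disjoint)
        (use assms(1) finM less.prems(1) in \<open>auto simp: disjoint_family_on_def\<close>)
    finally have "real (card M) = (\<Sum>j\<in>J. w j * q j)"
      using w by (simp add: q_def less_imp_neq[symmetric])
    \<comment> \<open>The largest ratio dominates the weighted average; the right side is exactly
      the drop of the potential.\<close>
    also have "\<dots> \<le> (\<Sum>j\<in>J. w j * q i)"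
      using qmax w by (intro sum_mono mult_left_mono) (auto intro: less_imp_le)
    finally have cM: "real (card M) \<le> sum w J * q i" by (simp add: sum_distrib_right)
    obtain X where X: "card (M \<inter> U i) \<le> k i" "X \<subseteq> M \<inter> U i" "indep_set G X"
      "painter_holds G (U i - X) (k i - card (M \<inter> U i))"
      using less.prems(3)[OF i(1)] Mi unfolding painter_holds_iff[of G "U i"] by blast
    define k' where "k' = k(i := k i - card (M \<inter> U i))"
    define U' where "U' = U(i := U i - X)"
    have ki: "real (k i) / w i = real (k' i) / w i + q i"
      using X(1) by (simp add: k'_def q_def of_nat_diff diff_divide_distrib)
    have split: "(\<Sum>j\<in>J. real (k j) / w j) = (\<Sum>j\<in>J. real (k' j) / w j) + q i"
      using assms(1) i(1) ki by (simp add: sum.remove[of J i] k'_def)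
    have W: "sum w J \<ge> 0" using w by (intro sum_nonneg) (auto intro: less_imp_le)
    have S': "(\<Sum>j\<in>J. real (k' j) / w j) \<ge> 0"
      using w by (intro sum_nonneg) (auto intro!: divide_nonneg_nonneg intro: less_imp_le)
    have eq: "sum w J * (\<Sum>j\<in>J. real (k j) / w j) =
        sum w J * (\<Sum>j\<in>J. real (k' j) / w j) + sum w J * q i"
      unfolding split by (simp add: distrib_left)
    \<comment> \<open>The remaining potential is nonnegative, so the drop, and with it
      \<open>card M\<close>, stays below \<open>K + 1\<close>.\<close>
    have "sum w J * (\<Sum>j\<in>J. real (k' j) / w j) \<ge> 0" using W S' by simp
    then have "real (card M) < real K + 1" using eq cM less.prems(4) by linarith
    then have KM: "card M \<le> K" by linarith
    have "painter_holds G (\<Union>j\<in>J. U' j) (K - card M)"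
    proof (rule less.IH)
      show "K - card M < K" using posM KM by linarith
      show "disjoint_family_on U' J"
        using less.prems(1) by (auto simp: disjoint_family_on_def U'_def)
      show "finite (U' j)" if "j \<in> J" for j
        using less.prems(2)[OF that] by (auto simp: U'_def)
      show "painter_holds G (U' j) (k' j)" if "j \<in> J" for j
        using less.prems(3) that X(4) by (simp add: U'_def k'_def)
      show "sum w J * (\<Sum>i\<in>J. real (k' i) / w i) < real (K - card M) + 1"
        using eq cM less.prems(4) KM by (simp add: of_nat_diff)
    qed
    moreover have "U j \<inter> X = {}" if "j \<in> J" "j \<noteq> i" for j
      using disjoint_family_onD[OF less.prems(1) that(1) i(1) that(2)] X(2) by blast
    then have "(\<Union>j\<in>J. U' j) = (\<Union>j\<in>J. U j) - X"
      unfolding U'_def by (auto split: if_splits)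
    ultimately show "card M \<le> K \<and>
        (\<exists>X\<subseteq>M. indep_set G X \<and> painter_holds G ((\<Union>j\<in>J. U j) - X) (K - card M))"
      using KM X by auto
  qed
qed

text \<open>As \<open>k i / w i\<close> is at most \<open>card (V i)\<close>, the initial potential
  is at most the total weight times \<open>card (verts G)\<close>.\<close>

lemma sum_color_cost_weighted_partition:
  fixes w :: "'i \<Rightarrow> real" and k :: "'i \<Rightarrow> nat"
  assumes "graph G" "finite J" "\<And>i. i \<in> J \<Longrightarrow> w i > 0"
    and "disjoint_family_on V J" "verts G = (\<Union>i\<in>J. V i)"
    and "\<And>i. i \<in> J \<Longrightarrow> painter_holds G (V i) (k i)"
    and "\<And>i. i \<in> J \<Longrightarrow> real (k i) \<le> w i * real (card (V i))"
  shows "real (sum_color_cost G) \<le> sum w J * real (card (verts G))"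
proof -
  interpret graph G by fact
  have fin: "finite (V i)" if "i \<in> J" for i
    using that assms(5) finite_verts by (metis UN_upper finite_subset)
  have "card (verts G) = (\<Sum>i\<in>J. card (V i))"
    unfolding assms(5)
    by (rule card_UN_disjoint) (use assms(2,4) fin in \<open>auto simp: disjoint_family_on_def\<close>)
  moreover have "(\<Sum>i\<in>J. real (k i) / w i) \<le> (\<Sum>i\<in>J. real (card (V i)))"
    using assms(3,7) by (intro sum_mono) (simp add: divide_le_eq mult.commute)
  ultimately have "(\<Sum>i\<in>J. real (k i) / w i) \<le> real (card (verts G))" by simp
  moreover have W: "sum w J \<ge> 0" using assms(3) by (intro sum_nonneg) (auto intro: less_imp_le)
  ultimately have le: "sum w J * (\<Sum>i\<in>J. real (k i) / w i) \<le> sum w J * real (card (verts G))"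
    by (rule mult_left_mono)
  \<comment> \<open>Rounding down is harmless, since the combined strategy accepts any potential
    below \<open>K + 1\<close>.\<close>
  define K where "K = nat \<lfloor>sum w J * real (card (verts G))\<rfloor>"
  have nonneg: "sum w J * real (card (verts G)) \<ge> 0" using W by simp
  then have K: "real K \<le> sum w J * real (card (verts G))"
    "sum w J * real (card (verts G)) < real K + 1"
    unfolding K_def by linarith+
  have "painter_holds G (\<Union>i\<in>J. V i) K"
    by (rule painter_holds_weighted_union[OF assms(2,3,4) fin assms(6)]) (use le K in auto)
  then have "sum_color_cost G \<le> K"
    using painter_holds_iff_sum_color_cost_le[OF assms(1)] assms(5) by simp
  then show ?thesis using K(1) by linarith
qed

theorem theorem8:
  fixes G :: "('a, 'b) pre_digraph" and t :: nat
  assumes "graph G"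
  shows "((\<exists>F :: nat \<Rightarrow> 'a set.
            disjoint_family_on F {..<t} \<and> verts G = (\<Union>i<t. F i) \<and>
            (\<forall>i<t. undirected_forest (G \<restriction> F i))) \<longrightarrow>
         real (sum_color_cost G) \<le> 3 * real t / 2 * real (card (verts G))) \<and>
         (t \<ge> 1 \<and>
         (\<exists>I. \<exists>F :: nat \<Rightarrow> 'a set.
            disjoint_family_on F {..<t - 1} \<and> I \<inter> (\<Union>i<t - 1. F i) = {} \<and>
            verts G = I \<union> (\<Union>i<t - 1. F i) \<and>
            indep_set G I \<and> (\<forall>i<t - 1. undirected_forest (G \<restriction> F i))) \<longrightarrow>
         real (sum_color_cost G) \<le> (3 * real t - 1) / 2 * real (card (verts G)))"
proof (intro conjI impI; elim exE conjE)
  interpret graph G by fact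
  fix F :: "nat \<Rightarrow> 'a set"
  assume F: "disjoint_family_on F {..<t}" "verts G = (\<Union>i<t. F i)"
    "\<forall>i<t. undirected_forest (G \<restriction> F i)"
  have "real (sum_color_cost G) \<le> (\<Sum>i<t. 3 / 2) * real (card (verts G))"
  proof (rule sum_color_cost_weighted_partition[OF assms _ _ F(1,2)])
    show "painter_holds G (F i) (3 * card (F i) div 2)" if "i \<in> {..<t}" for i
      using that F by (intro painter_holds_forest) auto
  qed auto
  then show "real (sum_color_cost G) \<le> 3 * real t / 2 * real (card (verts G))"
    by (simp add: mult.commute)
next
  interpret graph G by fact
  fix I and F :: "nat \<Rightarrow> 'a set"
  assume t: "1 \<le> t" and F: "disjoint_family_on F {..<t - 1}" "I \<inter> (\<Union>i<t - 1. F i) = {}"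
    "verts G = I \<union> (\<Union>i<t - 1. F i)" "indep_set G I"
    "\<forall>i<t - 1. undirected_forest (G \<restriction> F i)"
  define n where "n = t - 1"
  have tn: "t = Suc n" using t by (simp add: n_def)
  \<comment> \<open>The independent set takes the free index \<open>n\<close> with weight 1, for a
    total of \<open>3 / 2 * n + 1 = (3 * t - 1) / 2\<close>.\<close>
  define V where "V = F(n := I)"
  define w :: "nat \<Rightarrow> real" where "w = (\<lambda>_. 3 / 2)(n := 1)"
  define k where "k = (\<lambda>i. 3 * card (F i) div 2)(n := card I)"
  have "real (sum_color_cost G) \<le> sum w {..<t} * real (card (verts G))"
  proof (rule sum_color_cost_weighted_partition[OF assms])
    show "disjoint_family_on V {..<t}"
      unfolding disjoint_family_on_def
    proof (intro ballI impI)
      fix i j assume "i \<in> {..<t}" "j \<in> {..<t}" "i \<noteq> j"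
      then consider "i < n" "j < n" | "i = n" "j < n" | "i < n" "j = n" using tn by fastforce
      then show "V i \<inter> V j = {}"
      proof cases
        case 1
        then have "F i \<inter> F j = {}"
          using F(1) \<open>i \<noteq> j\<close> unfolding disjoint_family_on_def n_def by simp
        then show ?thesis using 1 by (simp add: V_def)
      qed (use F(2) in \<open>auto simp: V_def n_def\<close>)
    qed
    show "verts G = (\<Union>i<t. V i)"
      using F(3) unfolding n_def[symmetric] tn by (auto simp: V_def less_Suc_eq)
    show "painter_holds G (V i) (k i)" if "i \<in> {..<t}" for i
    proof (cases "i = n")
      case True
      have "finite I" using F(3) finite_verts by (metis finite_Un)
      then show ?thesis using painter_holds_indep_set[OF F(4)] True by (simp add: V_def k_def)
    next
      case False
      then have "i < n" using that tn by simp
      then have "painter_holds G (F i) (3 * card (F i) div 2)"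
        using F(3,5) unfolding n_def by (intro painter_holds_forest) auto
      then show ?thesis using False by (simp add: V_def k_def)
    qed
  qed (auto simp: w_def k_def V_def)
  moreover have "sum w {..<t} = (3 * real t - 1) / 2"
    unfolding tn by (simp add: w_def field_simps)
  ultimately show "real (sum_color_cost G) \<le> (3 * real t - 1) / 2 * real (card (verts G))"
    by simp
qed

end
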